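(* Let $n$ be a positive integer and let $\tau,\tau'$ be real numbers such that $0\le\tau'<\tau\le n$. For each integer $t\ge0$ let $A_t$ be a row-stochastic matrix and $\mathcal{E}_t$ a real diagonal matrix, both of size $n$, let $B_t=A_t-\mathcal{E}_t$, and let $V_t\in\mathbb{R}^n$ be given by $V_t(i)=|A_t(i,i)-\mathcal{E}_t(i)|$. Suppose that for each integer $t\ge0$, $$\mathrm{tr}\,A_t-\mathbf{1}^\top V_t\ge\tau\quad\text{and}\quad |B_t(i,j)|\le\frac{1}{n-\tau'}\ \text{ for all } i,j\in\{1,\dots,n\}.$$ Let $Y_0\in\mathbb{R}^n$ and $Y_{t+1}=B_tY_t$ for all $t\ge0$. Then $\lim_{t\to\infty}Y_t=0$.
   Context: A nonnegative real square matrix is row stochastic if each row-sum equals $1$. $\mathbf{1}$ is the all-ones vector in $\mathbb{R}^n$; $\mathcal{E}_t(i)$ is the $i$-th diagonal entry of $\mathcal{E}_t$. In the paper, $Y_t=X_t-\bar\sigma$ is the error of the dynamics $X_{t+1}=A_tX_t+\mathcal{E}_t(\bar\sigma-X_t)$ with $\bar\sigma$ a multiple of $\mathbf{1}$, which is equivalent to $Y_{t+1}=B_tY_t$. *)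

theory Defs
  imports "HOL-Analysis.Analysis"
begin

definition row_stochastic :: "real^'n^'n \<Rightarrow> bool" where
  "row_stochastic A \<longleftrightarrow> (\<forall>i j. 0 \<le> A $ i $ j) \<and> (\<forall>i. (\<Sum>j\<in>UNIV. A $ i $ j) = 1)"

definition diagonal_mat :: "real^'n^'n \<Rightarrow> bool" where
  "diagonal_mat D \<longleftrightarrow> (\<forall>i j. i \<noteq> j \<longrightarrow> D $ i $ j = 0)"

end

theory Submission
  imports Defs
begin

text \<open>Since A is row stochastic and the diagonal of B is controlled by V, the absolute values of all
  entries of B sum to at most n - tau. Hence with S the 1-norm of Y, one step gives
  sup norm at most S / (n - tau'), and a second step gives 1-norm at most
  (n - tau) / (n - tau') * S. Thus the 1-norm contracts by a fixed factor every two steps.\<close>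

text \<open>Off the diagonal \<open>A - D\<close> agrees with the nonnegative \<open>A\<close>, so
  the absolute values there sum to \<open>1 - A $ i $ i\<close> in row \<open>i\<close>. Only the
  diagonal entry can change sign, and it is kept as a separate term.\<close>

lemma sum_abs_row_stochastic_minus_diagonal:
  fixes A D :: "real^'n^'n"
  assumes "row_stochastic A" and "diagonal_mat D"
  shows "(\<Sum>i\<in>UNIV. \<Sum>j\<in>UNIV. \<bar>(A - D) $ i $ j\<bar>)
    = real CARD('n) - trace A + (\<Sum>i\<in>UNIV. \<bar>A $ i $ i - D $ i $ i\<bar>)"
proof -
  have row: "(\<Sum>j\<in>UNIV. \<bar>(A - D) $ i $ j\<bar>) = 1 - A $ i $ i + \<bar>A $ i $ i - D $ i $ i\<bar>" for i
  proof -
    have "(\<Sum>j\<in>UNIV - {i}. \<bar>(A - D) $ i $ j\<bar>) = (\<Sum>j\<in>UNIV - {i}. A $ i $ j)"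
      using assms by (intro sum.cong) (auto simp: row_stochastic_def diagonal_mat_def)
    moreover have "(\<Sum>j\<in>UNIV. A $ i $ j) = 1"
      using assms(1) by (simp add: row_stochastic_def)
    ultimately show ?thesis
      by (simp add: sum.remove[of UNIV i])
  qed
  show ?thesis
    by (simp only: row) (simp add: sum.distrib sum_subtractf trace_def)
qed

lemma abs_matrix_vector_mult_le:
  fixes B :: "real^'n^'m"
  shows "\<bar>(B *v x) $ i\<bar> \<le> (\<Sum>j\<in>UNIV. \<bar>B $ i $ j\<bar> * \<bar>x $ j\<bar>)"
  unfolding matrix_vector_mult_def by (auto simp: abs_mult intro: order_trans[OF sum_abs])

text \<open>Even and odd indices form two sequences, started at \<open>S 0\<close> and
  \<open>S 1\<close>, and each decays geometrically with ratio \<open>c\<close>.\<close>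

lemma tendsto_zero_if_two_step_contraction:
  fixes S :: "nat \<Rightarrow> real"
  assumes nonneg: "\<And>t. 0 \<le> S t" and c: "0 \<le> c" "c < 1"
    and contract: "\<And>t. S (Suc (Suc t)) \<le> c * S t"
  shows "S \<longlonglongrightarrow> 0"
proof -
  \<comment> \<open>The sum \<open>S 0 + S 1\<close> dominates both starting values, so one bound
    serves both parities. The base cases survive \<open>c = 0\<close> because
    \<open>0 ^ 0 = 1\<close>.\<close>
  have bound: "S t \<le> c ^ (t div 2) * (S 0 + S 1)" for t
  proof (induction t rule: nat_induct2)
    case (step t)
    have "S (t + 2) \<le> c * S t" using contract[of t] by simp
    also have "\<dots> \<le> c * (c ^ (t div 2) * (S 0 + S 1))"
      using step c by (intro mult_left_mono) auto
    finally show ?case by (simp add: mult.assoc)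
  qed (use nonneg[of 0] nonneg[of 1] in auto)
  have "(\<lambda>t. c ^ (t div 2)) \<longlonglongrightarrow> 0"
    using LIMSEQ_realpow_zero[OF c] by (rule filterlim_compose) (rule filterlim_at_top_div_const_nat, simp)
  then have "(\<lambda>t. c ^ (t div 2) * (S 0 + S 1)) \<longlonglongrightarrow> 0"
    by (rule tendsto_mult_left_zero)
  then show ?thesis
    by (rule Lim_null_comparison[rotated]) (simp add: nonneg bound[simplified])
qed

theorem theorem3p7:
  fixes A \<E> B :: "nat \<Rightarrow> real^'n^'n"
    and V Y :: "nat \<Rightarrow> real^'n"
    and \<tau> \<tau>' :: real
  assumes "0 \<le> \<tau>'" and "\<tau>' < \<tau>" and "\<tau> \<le> real CARD('n)"
    and "\<And>t. row_stochastic (A t)"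
    and "\<And>t. diagonal_mat (\<E> t)"
    and "\<And>t. B t = A t - \<E> t"
    and "\<And>t. V t = (\<chi> i. \<bar>A t $ i $ i - \<E> t $ i $ i\<bar>)"
    and "\<And>t. trace (A t) - 1 \<bullet> V t \<ge> \<tau>"
    and "\<And>t i j. \<bar>B t $ i $ j\<bar> \<le> 1 / (real CARD('n) - \<tau>')"
    and "\<And>t. Y (Suc t) = B t *v Y t"
  shows "Y \<longlonglongrightarrow> 0"
proof -
  let ?n = "real CARD('n)"
  define S where "S t = (\<Sum>i\<in>UNIV. \<bar>Y t $ i\<bar>)" for t
  have pos: "0 < ?n - \<tau>'" using assms(2,3) by linarith
  have total: "(\<Sum>i\<in>UNIV. \<Sum>j\<in>UNIV. \<bar>B t $ i $ j\<bar>) \<le> ?n - \<tau>" for t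
  proof -
    \<comment> \<open>Here \<open>1\<close> is the all-ones vector, so the inner product adds up the
      entries of \<open>V t\<close>.\<close>
    have "1 \<bullet> V t = (\<Sum>i\<in>UNIV. \<bar>A t $ i $ i - \<E> t $ i $ i\<bar>)"
      by (simp add: inner_vec_def assms(7))
    then show ?thesis
      using assms(8)[of t] sum_abs_row_stochastic_minus_diagonal[OF assms(4,5), of t t]
      by (simp add: assms(6))
  qed
  have sup: "\<bar>Y (Suc t) $ i\<bar> \<le> S t / (?n - \<tau>')" for t i
  proof -
    have "\<bar>Y (Suc t) $ i\<bar> \<le> (\<Sum>j\<in>UNIV. \<bar>B t $ i $ j\<bar> * \<bar>Y t $ j\<bar>)"
      unfolding assms(10) by (rule abs_matrix_vector_mult_le)
    also have "\<dots> \<le> (\<Sum>j\<in>UNIV. 1 / (?n - \<tau>') * \<bar>Y t $ j\<bar>)"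
      by (intro sum_mono mult_right_mono assms(9)) auto
    also have "\<dots> = S t / (?n - \<tau>')" by (simp add: S_def sum_divide_distrib)
    finally show ?thesis .
  qed
  have S_nonneg: "0 \<le> S t" for t by (simp add: S_def sum_nonneg)
  have contract: "S (Suc (Suc t)) \<le> (?n - \<tau>) / (?n - \<tau>') * S t" for t
  proof -
    have "S (Suc (Suc t)) \<le> (\<Sum>i\<in>UNIV. \<Sum>j\<in>UNIV. \<bar>B (Suc t) $ i $ j\<bar> * \<bar>Y (Suc t) $ j\<bar>)"
      unfolding S_def assms(10)[of "Suc t"] by (intro sum_mono abs_matrix_vector_mult_le)
    \<comment> \<open>The bound \<open>sup\<close> does not depend on \<open>j\<close>, so it
      factors out and leaves the entry sum estimated by \<open>total\<close>.\<close>
    also have "\<dots> \<le> (\<Sum>i\<in>UNIV. \<Sum>j\<in>UNIV. \<bar>B (Suc t) $ i $ j\<bar> * (S t / (?n - \<tau>')))"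
      by (intro sum_mono mult_left_mono sup) auto
    also have "\<dots> = (\<Sum>i\<in>UNIV. \<Sum>j\<in>UNIV. \<bar>B (Suc t) $ i $ j\<bar>) * (S t / (?n - \<tau>'))"
      by (simp only: sum_distrib_right)
    also have "\<dots> \<le> (?n - \<tau>) * (S t / (?n - \<tau>'))"
      using pos S_nonneg by (intro mult_right_mono total) auto
    finally show ?thesis by simp
  qed
  \<comment> \<open>The contraction factor is nonnegative by \<open>\<tau> \<le> n\<close> and below
    1 by \<open>\<tau>' < \<tau>\<close>; it is 0 when \<open>\<tau> = n\<close>.\<close>
  have "S \<longlonglongrightarrow> 0"
    by (rule tendsto_zero_if_two_step_contraction[where S = S, OF S_nonneg _ _ contract])
      (use pos assms(2,3) in auto)
  \<comment> \<open>The Euclidean norm of \<open>Y t\<close> is at most its 1-norm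
    \<open>S t\<close>.\<close>
  then show ?thesis
    by (rule Lim_null_comparison[rotated]) (simp add: S_def norm_le_l1_cart)
qed

end
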